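(* (Correctness of the RVF Algorithm) At termination of the RVF Algorithm, we have $z(\zeta)=\bar z^k(\zeta)$ for all $\zeta\in\mathcal{C}$, so that $\mathcal{S}^k$ describes both the restricted value function $z$ and the efficient frontier. Furthermore, the RVF Algorithm terminates in finitely many iterations under the assumption that $X_{\rm MO}$ is bounded.
   Context: Data: $A\in\mathbb{Q}^{m\times n}$, $b\in\mathbb{Q}^m$, and $C\in\mathbb{Q}^{(\ell+1)\times n}$ with rows $c^0,c^1,\dots,c^\ell$; $C^{1:\ell}$ is the submatrix of $C$ with rows $c^1,\dots,c^\ell$. The first $r$ variables are integer and the last $n-r$ are continuous; a subscript $I$ (resp. $C$) on a matrix or row vector denotes its columns corresponding to the integer (resp. continuous) variables. $X_{\rm MO}=\{(x_I,x_C)\in\mathbb{Z}_+^r\times\mathbb{R}_+^{n-r}: A_Ix_I+A_Cx_C=b\}$ is assumed bounded throughout. For $\zeta\in\mathbb{R}^\ell$ let $\mathcal{S}(\zeta)=\{(x_I,x_C)\in X_{\rm MO}: C_I^{1:\ell}x_I+C_C^{1:\ell}x_C\le\zeta\}$ and $\mathcal{C}=\{\zeta\in\mathbb{R}^\ell:\mathcal{S}(\zeta)\ne\emptyset\}$. The restricted value function (RVF, or VF) is $z(\zeta)=\inf_{(x_I,x_C)\in\mathcal{S}(\zeta)}c^0_Ix_I+c^0_Cx_C$, with $z(\zeta)=+\infty$ for $\zeta\notin\mathcal{C}$. The efficient frontier (EF) is the set of nondominated vectors $C_Ix_I+C_Cx_C$, $(x_I,x_C)\in X_{\rm MO}$,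 where a vector dominates another if it is componentwise $\le$ and not equal to it; a feasible solution is efficient if its vector is nondominated. Let $\mathcal{S}_I=\bigcup_{\zeta\in\mathcal{C}}\{x_I\in\mathbb{Z}_+^r:\exists x_C,\ (x_I,x_C)\in\mathcal{S}(\zeta)\}$. For $\beta\in\mathbb{R}^m$ let $z_{\rm LP}(\zeta;\beta)=\inf\{c^0_Cx_C: C_C^{1:\ell}x_C\le\zeta,\ A_Cx_C=\beta,\ x_C\in\mathbb{R}_+^{n-r}\}$ ($+\infty$ if infeasible), and for $x_I\in\mathcal{S}_I$ let $\bar z(\zeta;x_I)=c^0_Ix_I+z_{\rm LP}(\zeta-C_I^{1:\ell}x_I;\ b-A_Ix_I)$. Meaning of "describes". A set $\mathcal{S}\subseteq\mathcal{S}_I$ describes (is a description of) the restricted value function if for every $\zeta\in\mathcal{C}$ there exist $x_I\in\mathcal{S}$ and $x_C\in\mathbb{R}_+^{n-r}$ with $C_I^{1:\ell}x_I+C_C^{1:\ell}x_C\le\zeta$, $A_Ix_I+A_Cx_C=b$ and $c^0_Ix_I+c^0_Cx_C=z(\zeta)$; for such a set, $z(\zeta)=\min_{x_I\in\mathcal{S}}\bar z(\zeta;x_I)$ for all $\zeta\in\mathcal{C}$. A set $\mathcal{S}\subseteq\mathcal{S}_I$ describes the efficient frontier if for every $\gamma$ in the efficient frontier there is $(x_I,x_C)\in X_{\rm MO}$ with $x_I\in\mathcal{S}$ and $\gamma=C_Ix_I+C_Cx_C$. RVF Algorithm. Input: $X_{\rm MO}$, $C$, and $U\in\mathbb{R}$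 with $z(\zeta)\le U$ for all $\zeta\in\mathcal{C}$. Stated output: $\mathcal{S}^k$ such that $z(\zeta)=\bar z^k(\zeta)=\min_{x_I\in\mathcal{S}^k}\bar z(\zeta;x_I)$ for all $\zeta\in\mathcal{C}$. Initialize $\bar z^0(\zeta)=U$ for all $\zeta\in\mathbb{R}^\ell$, $k=0$, $\mathcal{S}^0=\emptyset$, $\theta^0=+\infty$. While $\theta^k>0$ do: (i) determine $(x_I^{k+1},x_C^{k+1})\in\operatorname{argmax}_{(x_I,x_C)\in X_{\rm MO}}\big(\bar z^k(C_I^{1:\ell}x_I+C_C^{1:\ell}x_C)-(c^0_Ix_I+c^0_Cx_C)\big)$; (ii) convert $(x_I^{k+1},x_C^{k+1})$ to an efficient solution, for example by replacing it by a minimizer of $\mathbf{1}^\top(C_Ix_I+C_Cx_C)$ over $(x_I,x_C)\in X_{\rm MO}$ with $C_Ix_I+C_Cx_C\le C_Ix_I^{k+1}+C_Cx_C^{k+1}$; (iii) set $\mathcal{S}^{k+1}=\mathcal{S}^k\cup\{x_I^{k+1}\}$; (iv) set $\theta^{k+1}=\bar z^k(C_I^{1:\ell}x_I^{k+1}+C_C^{1:\ell}x_C^{k+1})-(c^0_Ix_I^{k+1}+c^0_Cx_C^{k+1})$; (v) set $\bar z^{k+1}(\zeta)=\min\{\bar z^k(\zeta),\bar z(\zeta;x_I^{k+1})\}$ for all $\zeta\in\mathcal{C}$; (vi) $k\leftarrow k+1$. Thus $\bar z^k(\zeta)=\min\{\min_{x_I\in\mathcal{S}^k}\bar z(\zeta;x_I),\,U\}$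 for $\zeta\in\mathcal{C}$.
   Formalization: That S^k describes z and the efficient frontier is claimed only if z(ζ)<U on C (it can fail when U equals a value of z); termination is a uniform bound on the number of iterations, and a next iteration is guaranteed only when the maximum in step (i) is attained. *)

theory Defs
  imports "HOL-Analysis.Analysis"
begin

text \<open>
  The variables are indexed by the finite type \<open>'n\<close>; \<open>I :: 'n set\<close> is the set of integer variables
  and its complement the set of continuous ones, so that either set may be empty.  The parts
  \<open>x\<^sub>I\<close> and \<open>x\<^sub>C\<close> of a point are kept in \<open>real^'n\<close>, padded with zeros outside \<open>I\<close>, respectively
  inside \<open>I\<close>.  Hence \<open>(x\<^sub>I, x\<^sub>C)\<close> is the vector \<open>x\<^sub>I + x\<^sub>C\<close>, and \<open>A *v x\<^sub>I\<close>, \<open>A *v x\<^sub>C\<close> are the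
  products with the submatrices of integer and of continuous columns.

  The rows of \<open>C\<close> are indexed by \<open>'l option\<close>: row \<open>None\<close> is \<open>c\<^sup>0\<close> and row \<open>Some i\<close> is \<open>c\<^sup>i\<close>.
  The order \<open>\<le>\<close> on vectors is the componentwise one.
\<close>

definition int_vecs :: "'n::finite set \<Rightarrow> (real^'n) set" where
  "int_vecs I = {x. (\<forall>j. 0 \<le> x $ j) \<and> (\<forall>j\<in>I. x $ j \<in> \<int>) \<and> (\<forall>j. j \<notin> I \<longrightarrow> x $ j = 0)}"

definition cont_vecs :: "'n::finite set \<Rightarrow> (real^'n) set" where
  "cont_vecs I = {x. (\<forall>j. 0 \<le> x $ j) \<and> (\<forall>j\<in>I. x $ j = 0)}"

definition int_part :: "'n::finite set \<Rightarrow> real^'n \<Rightarrow> real^'n" where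
  "int_part I x = (\<chi> j. if j \<in> I then x $ j else 0)"

definition c0 :: "real^'n::finite^('l::finite option) \<Rightarrow> real^'n" where
  "c0 C = C $ None"

definition C1 :: "real^'n::finite^('l::finite option) \<Rightarrow> real^'n^'l" where
  "C1 C = (\<chi> i. C $ Some i)"

definition X_MO :: "real^'n::finite^'m::finite \<Rightarrow> real^'m \<Rightarrow> 'n set \<Rightarrow> (real^'n) set" where
  "X_MO A b I = {x. (\<forall>j. 0 \<le> x $ j) \<and> (\<forall>j\<in>I. x $ j \<in> \<int>) \<and> A *v x = b}"

definition feas ::
  "real^'n::finite^'m::finite \<Rightarrow> real^'m \<Rightarrow> 'n set \<Rightarrow> real^'n^('l::finite option) \<Rightarrow> real^'l \<Rightarrow> (real^'n) set"
  where "feas A b I C \<zeta> = {x \<in> X_MO A b I. C1 C *v x \<le> \<zeta>}"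

definition feas_rhs ::
  "real^'n::finite^'m::finite \<Rightarrow> real^'m \<Rightarrow> 'n set \<Rightarrow> real^'n^('l::finite option) \<Rightarrow> (real^'l) set"
  where "feas_rhs A b I C = {\<zeta>. feas A b I C \<zeta> \<noteq> {}}"

text \<open>In \<open>ereal\<close> the infimum of the empty set is \<open>\<infinity>\<close>.\<close>

definition rvf ::
  "real^'n::finite^'m::finite \<Rightarrow> real^'m \<Rightarrow> 'n set \<Rightarrow> real^'n^('l::finite option) \<Rightarrow> real^'l \<Rightarrow> ereal"
  where "rvf A b I C \<zeta> = (INF x \<in> feas A b I C \<zeta>. ereal (c0 C \<bullet> x))"

definition dominates :: "real^'k::finite \<Rightarrow> real^'k \<Rightarrow> bool" where
  "dominates v w \<longleftrightarrow> v \<le> w \<and> v \<noteq> w"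

definition efficient_frontier ::
  "real^'n::finite^'m::finite \<Rightarrow> real^'m \<Rightarrow> 'n set \<Rightarrow> real^'n^('l::finite option) \<Rightarrow> (real^('l option)) set"
  where "efficient_frontier A b I C =
    {C *v x | x. x \<in> X_MO A b I \<and> \<not> (\<exists>y \<in> X_MO A b I. dominates (C *v y) (C *v x))}"

definition efficient ::
  "real^'n::finite^'m::finite \<Rightarrow> real^'m \<Rightarrow> 'n set \<Rightarrow> real^'n^('l::finite option) \<Rightarrow> real^'n \<Rightarrow> bool"
  where "efficient A b I C x \<longleftrightarrow> x \<in> X_MO A b I \<and> C *v x \<in> efficient_frontier A b I C"

definition S_I ::
  "real^'n::finite^'m::finite \<Rightarrow> real^'m \<Rightarrow> 'n set \<Rightarrow> real^'n^('l::finite option) \<Rightarrow> (real^'n) set"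
  where "S_I A b I C = (\<Union>\<zeta> \<in> feas_rhs A b I C.
    {xI \<in> int_vecs I. \<exists>xC \<in> cont_vecs I. xI + xC \<in> feas A b I C \<zeta>})"

definition z_LP ::
  "real^'n::finite^'m::finite \<Rightarrow> 'n set \<Rightarrow> real^'n^('l::finite option) \<Rightarrow> real^'l \<Rightarrow> real^'m \<Rightarrow> ereal"
  where "z_LP A I C \<zeta> \<beta> =
    (INF xC \<in> {xC \<in> cont_vecs I. C1 C *v xC \<le> \<zeta> \<and> A *v xC = \<beta>}. ereal (c0 C \<bullet> xC))"

definition zbar ::
  "real^'n::finite^'m::finite \<Rightarrow> real^'m \<Rightarrow> 'n set \<Rightarrow> real^'n^('l::finite option) \<Rightarrow> real^'l \<Rightarrow> real^'n \<Rightarrow> ereal"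
  where "zbar A b I C \<zeta> xI = ereal (c0 C \<bullet> xI) + z_LP A I C (\<zeta> - C1 C *v xI) (b - A *v xI)"

definition describes_rvf ::
  "real^'n::finite^'m::finite \<Rightarrow> real^'m \<Rightarrow> 'n set \<Rightarrow> real^'n^('l::finite option) \<Rightarrow> (real^'n) set \<Rightarrow> bool"
  where "describes_rvf A b I C S \<longleftrightarrow> S \<subseteq> S_I A b I C \<and>
    (\<forall>\<zeta> \<in> feas_rhs A b I C. \<exists>xI \<in> S. \<exists>xC \<in> cont_vecs I.
      C1 C *v xI + C1 C *v xC \<le> \<zeta> \<and> A *v xI + A *v xC = b \<and>
      ereal (c0 C \<bullet> xI + c0 C \<bullet> xC) = rvf A b I C \<zeta>)"

definition describes_ef ::
  "real^'n::finite^'m::finite \<Rightarrow> real^'m \<Rightarrow> 'n set \<Rightarrow> real^'n^('l::finite option) \<Rightarrow> (real^'n) set \<Rightarrow> bool"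
  where "describes_ef A b I C S \<longleftrightarrow> S \<subseteq> S_I A b I C \<and>
    (\<forall>\<gamma> \<in> efficient_frontier A b I C. \<exists>xI \<in> S. \<exists>xC \<in> cont_vecs I.
      xI + xC \<in> X_MO A b I \<and> \<gamma> = C *v xI + C *v xC)"

text \<open>
  A state of the RVF Algorithm is a triple \<open>(zk, Sk, \<theta>k)\<close>: the current upper approximation of the
  value function, the current set of integer parts, and the current gap.  The number of iterations
  performed is the exponent of the relational power \<open>rvf_step A b I C ^^ k\<close>.
\<close>

type_synonym ('n, 'l) rvf_state = "(real^'l \<Rightarrow> ereal) \<times> (real^'n) set \<times> ereal"

text \<open>
  \<open>U\<close> remains one of the functions whose minimum is \<open>zk\<close>.  If \<open>U\<close> equals a value of \<open>rvf\<close>, then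
  \<open>zk\<close> can agree with \<open>rvf\<close> there through \<open>U\<close> alone, without \<open>Sk\<close> describing \<open>rvf\<close>; this is
  excluded if \<open>U\<close> is a strict upper bound.
\<close>

definition rvf_init :: "real \<Rightarrow> ('n::finite, 'l::finite) rvf_state" where
  "rvf_init U = ((\<lambda>\<zeta>. ereal U), {}, \<infinity>)"

definition is_max_gap ::
  "real^'n::finite^'m::finite \<Rightarrow> real^'m \<Rightarrow> 'n set \<Rightarrow> real^'n^('l::finite option) \<Rightarrow>
    (real^'l \<Rightarrow> ereal) \<Rightarrow> real^'n \<Rightarrow> bool"
  where "is_max_gap A b I C zk x \<longleftrightarrow>
    is_arg_max (\<lambda>x. zk (C1 C *v x) - ereal (c0 C \<bullet> x)) (\<lambda>x. x \<in> X_MO A b I) x"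

text \<open>
  One pass through the loop body, guarded by \<open>\<theta>k > 0\<close>.  The maximizer \<open>y\<close> may be converted to any
  efficient solution \<open>x\<close> whose vector is componentwise at most that of \<open>y\<close>; a minimizer of the sum
  of the components of \<open>C *v x\<close> over the feasible \<open>x\<close> with \<open>C *v x \<le> C *v y\<close> is one such choice.
  The approximation is updated on \<open>feas_rhs A b I C\<close> only; its other values are never used.
\<close>

inductive rvf_step ::
  "real^'n::finite^'m::finite \<Rightarrow> real^'m \<Rightarrow> 'n set \<Rightarrow> real^'n^('l::finite option) \<Rightarrow>
    ('n, 'l) rvf_state \<Rightarrow> ('n, 'l) rvf_state \<Rightarrow> bool"
  for A b I C
  where
  "\<lbrakk>\<theta>k > 0;
    is_max_gap A b I C zk y;
    efficient A b I C x; C *v x \<le> C *v y\<rbrakk>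
   \<Longrightarrow> rvf_step A b I C (zk, Sk, \<theta>k)
        ((\<lambda>\<zeta>. if \<zeta> \<in> feas_rhs A b I C then min (zk \<zeta>) (zbar A b I C \<zeta> (int_part I x)) else zk \<zeta>),
         Sk \<union> {int_part I x},
         zk (C1 C *v x) - ereal (c0 C \<bullet> x))"

end

theory Submission
  imports Defs
begin

text \<open>
  The term \<open>zbar \<zeta> xI\<close> is the infimum of the same objective that defines \<open>rvf \<zeta>\<close>, taken only over the
  solutions whose integer part is \<open>xI\<close> (\<open>zbar_eq_INF_slice\<close>).  So on \<open>feas_rhs\<close> every approximation
  \<open>zk\<close> is the minimum of \<open>U\<close> and finitely many such restricted infima: it is at least \<open>rvf\<close>, it is
  antitone in \<open>\<zeta>\<close>, and at \<open>\<zeta> = C1 C *v x\<close> it is at most \<open>c0 C \<bullet> x\<close> as soon as the integer part of \<open>x\<close> has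
  been collected.  The three claims follow from these properties.

  Correctness.  Replacing the maximizer \<open>y\<close> by a solution \<open>x\<close> with \<open>C *v x \<le> C *v y\<close> does not
  decrease the gap, since \<open>zk\<close> is antitone and the objective does not increase.  Hence \<open>\<theta> \<le> 0\<close>
  certifies that the gap is nonpositive at every feasible solution, and antitonicity
  turns this into \<open>zk \<le> rvf\<close> on all of \<open>feas_rhs\<close> (\<open>approx_le_rvf\<close>).  If \<open>rvf\<close> stays strictly
  below \<open>U\<close>, the minimum is attained by a collected integer part, and the infimum over its
  continuous completions is attained because they form a compact set.  This gives a description of
  the value function (\<open>describes_rvf_if_approx_le\<close>), and any such description also describes the efficient frontier: a solution
  that is optimal for the right-hand side of an efficient one weakly dominates it, and so
  has the same vector.

  Termination.  Boundedness leaves only finitely many integer parts.  A positive gap at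
  \<open>x\<close> means that the integer part of \<open>x\<close> is new, so every iteration except possibly the last enlarges \<open>Sk\<close>
  (\<open>invariant_step\<close>).

  Progress.  Below a given maximizer there is an efficient solution, namely a
  minimizer of the sum of all objectives over a compact set (\<open>efficient_below\<close>).
\<close>

section \<open>Integer and continuous parts\<close>

lemma mult_vec_le_iff:
  fixes C :: "real^'n::finite^('l::finite option)"
  shows "C *v x \<le> C *v y \<longleftrightarrow> C1 C *v x \<le> C1 C *v y \<and> c0 C \<bullet> x \<le> c0 C \<bullet> y"
proof -
  have "(\<forall>i. (C *v x) $ i \<le> (C *v y) $ i) \<longleftrightarrow>
      (\<forall>i. (C *v x) $ Some i \<le> (C *v y) $ Some i) \<and> (C *v x) $ None \<le> (C *v y) $ None"
    by (metis option.exhaust)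
  then show ?thesis
    by (simp add: less_eq_vec_def matrix_vector_mul_component c0_def C1_def)
qed

lemma int_part_in_int_vecs: "x \<in> X_MO A b I \<Longrightarrow> int_part I x \<in> int_vecs I"
  by (auto simp: X_MO_def int_vecs_def int_part_def)

lemma diff_int_part_in_cont_vecs: "x \<in> X_MO A b I \<Longrightarrow> x - int_part I x \<in> cont_vecs I"
  by (auto simp: X_MO_def cont_vecs_def int_part_def)

lemma int_part_add:
  "xI \<in> int_vecs I \<Longrightarrow> xC \<in> cont_vecs I \<Longrightarrow> int_part I (xI + xC) = xI"
  by (auto simp: int_vecs_def cont_vecs_def int_part_def vec_eq_iff)

lemma add_in_feas_iff:
  assumes "xI \<in> int_vecs I" "xC \<in> cont_vecs I"
  shows "xI + xC \<in> feas A b I C \<zeta> \<longleftrightarrow>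
    C1 C *v xC \<le> \<zeta> - C1 C *v xI \<and> A *v xC = b - A *v xI"
proof -
  have "\<forall>j. 0 \<le> (xI + xC) $ j" "\<forall>j\<in>I. (xI + xC) $ j \<in> \<int>"
    using assms by (auto simp: int_vecs_def cont_vecs_def)
  then show ?thesis
    by (auto simp: feas_def X_MO_def matrix_vector_right_distrib algebra_simps)
qed

definition slice ::
  "real^'n::finite^'m::finite \<Rightarrow> real^'m \<Rightarrow> 'n set \<Rightarrow> real^'n^('l::finite option) \<Rightarrow> real^'l \<Rightarrow>
    real^'n \<Rightarrow> (real^'n) set"
  where "slice A b I C \<zeta> xI = {x \<in> feas A b I C \<zeta>. int_part I x = xI}"

lemma slice_eq_image:
  assumes "xI \<in> int_vecs I"
  shows "slice A b I C \<zeta> xI = (\<lambda>xC. xI + xC) `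
    {xC \<in> cont_vecs I. C1 C *v xC \<le> \<zeta> - C1 C *v xI \<and> A *v xC = b - A *v xI}"
proof (intro equalityI subsetI)
  fix x assume x: "x \<in> slice A b I C \<zeta> xI"
  then have "x \<in> X_MO A b I" and int: "int_part I x = xI" and fe: "x \<in> feas A b I C \<zeta>"
    by (auto simp: slice_def feas_def)
  then have diff: "x - xI \<in> cont_vecs I"
    using diff_int_part_in_cont_vecs by blast
  moreover have "C1 C *v (x - xI) \<le> \<zeta> - C1 C *v xI \<and> A *v (x - xI) = b - A *v xI"
    by (rule add_in_feas_iff[OF assms diff, THEN iffD1]) (simp add: fe)
  ultimately show "x \<in> (\<lambda>xC. xI + xC) `
    {xC \<in> cont_vecs I. C1 C *v xC \<le> \<zeta> - C1 C *v xI \<and> A *v xC = b - A *v xI}"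
    by (intro image_eqI[of _ _ "x - xI"]) auto
next
  fix x assume "x \<in> (\<lambda>xC. xI + xC) `
    {xC \<in> cont_vecs I. C1 C *v xC \<le> \<zeta> - C1 C *v xI \<and> A *v xC = b - A *v xI}"
  then obtain xC where x: "x = xI + xC" and xC: "xC \<in> cont_vecs I"
    and "C1 C *v xC \<le> \<zeta> - C1 C *v xI \<and> A *v xC = b - A *v xI"
    by blast
  from this(3) have "x \<in> feas A b I C \<zeta>"
    unfolding x by (rule add_in_feas_iff[OF assms xC, THEN iffD2])
  then show "x \<in> slice A b I C \<zeta> xI"
    using int_part_add[OF assms xC] by (simp add: slice_def x)
qed

lemma ereal_add_INF:
  fixes f :: "'a \<Rightarrow> ereal"
  shows "ereal r + (INF i\<in>S. f i) = (INF i\<in>S. ereal r + f i)"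
proof (rule antisym)
  show "ereal r + (INF i\<in>S. f i) \<le> (INF i\<in>S. ereal r + f i)"
    by (intro INF_greatest add_left_mono INF_lower)
  have "(INF i\<in>S. ereal r + f i) - ereal r \<le> (INF i\<in>S. f i)"
  proof (rule INF_greatest)
    fix i assume "i \<in> S"
    then have "(INF i\<in>S. ereal r + f i) \<le> ereal r + f i"
      by (rule INF_lower)
    then show "(INF i\<in>S. ereal r + f i) - ereal r \<le> f i"
      by (simp add: ereal_minus_le_iff add.commute)
  qed
  then show "(INF i\<in>S. ereal r + f i) \<le> ereal r + (INF i\<in>S. f i)"
    by (simp add: ereal_minus_le_iff add.commute)
qed

text \<open>
  The linear program inside \<open>zbar\<close> optimizes over the continuous completions of \<open>xI\<close>.  Adding
  \<open>xI\<close> back identifies them with the solutions in the slice and absorbs the constant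
  \<open>c0 C \<bullet> xI\<close>, which puts \<open>zbar\<close> in the same form as \<open>rvf\<close>.
\<close>

lemma zbar_eq_INF_slice:
  assumes "xI \<in> int_vecs I"
  shows "zbar A b I C \<zeta> xI = (INF x \<in> slice A b I C \<zeta> xI. ereal (c0 C \<bullet> x))"
  unfolding zbar_def z_LP_def slice_eq_image[OF assms] ereal_add_INF image_image
  by (simp add: inner_add_right)

lemma rvf_le_zbar: "xI \<in> int_vecs I \<Longrightarrow> rvf A b I C \<zeta> \<le> zbar A b I C \<zeta> xI"
  unfolding rvf_def zbar_eq_INF_slice by (rule INF_superset_mono) (auto simp: slice_def)

lemma zbar_antimono:
  assumes "xI \<in> int_vecs I" "\<zeta> \<le> \<zeta>'"
  shows "zbar A b I C \<zeta>' xI \<le> zbar A b I C \<zeta> xI"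
  unfolding zbar_eq_INF_slice[OF assms(1)] using assms(2)
  by (intro INF_superset_mono) (auto simp: slice_def feas_def)

lemma zbar_int_part_le:
  assumes "x \<in> X_MO A b I"
  shows "zbar A b I C (C1 C *v x) (int_part I x) \<le> ereal (c0 C \<bullet> x)"
  unfolding zbar_eq_INF_slice[OF int_part_in_int_vecs[OF assms]] using assms
  by (intro INF_lower) (auto simp: slice_def feas_def)

lemma mult_vec_in_feas_rhs: "x \<in> X_MO A b I \<Longrightarrow> C1 C *v x \<in> feas_rhs A b I C"
  by (auto simp: feas_rhs_def feas_def)

lemma int_part_in_S_I:
  assumes "x \<in> X_MO A b I"
  shows "int_part I x \<in> S_I A b I C"
proof -
  have "int_part I x + (x - int_part I x) \<in> feas A b I C (C1 C *v x)"
    using assms by (simp add: feas_def)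
  then have "\<exists>xC\<in>cont_vecs I. int_part I x + xC \<in> feas A b I C (C1 C *v x)"
    using diff_int_part_in_cont_vecs[OF assms] by (rule bexI)
  then show ?thesis
    unfolding S_I_def
    using int_part_in_int_vecs[OF assms] mult_vec_in_feas_rhs[OF assms, of C]
    by (intro UN_I[of "C1 C *v x"]) simp_all
qed

section \<open>Consequences of boundedness\<close>

lemma closed_X_MO:
  fixes A :: "real^'n::finite^'m::finite"
  shows "closed (X_MO A b I)"
proof -
  have "X_MO A b I =
      {x. \<forall>j. 0 \<le> x $ j} \<inter> (\<Inter>j\<in>I. (\<lambda>x. x $ j) -` \<int>) \<inter> {x. A *v x = b}"
    by (auto simp: X_MO_def)
  moreover have "closed {x::real^'n. \<forall>j. 0 \<le> x $ j}"
    by (intro closed_Collect_all closed_Collect_le continuous_intros)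
  moreover have "closed ((\<lambda>x::real^'n. x $ j) -` \<int>)" for j
    by (intro closed_vimage closed_Ints continuous_intros)
  moreover have "closed {x. A *v x = b}"
    by (intro closed_Collect_eq continuous_intros)
  ultimately show ?thesis
    by (auto intro!: closed_Int closed_INT)
qed

lemma closed_mult_vec_le:
  fixes M :: "real^'n::finite^'k::finite"
  shows "closed {x. M *v x \<le> v}"
  unfolding less_eq_vec_def
  by (intro closed_Collect_all closed_Collect_le continuous_intros)

lemma compact_slice:
  fixes A :: "real^'n::finite^'m::finite"
  assumes "bounded (X_MO A b I)"
  shows "compact (slice A b I C \<zeta> xI)"
proof -
  have "slice A b I C \<zeta> xI =
      X_MO A b I \<inter> {x. C1 C *v x \<le> \<zeta>} \<inter> {x. \<forall>j. (if j \<in> I then x $ j else 0) = xI $ j}"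
    by (auto simp: slice_def feas_def int_part_def vec_eq_iff)
  moreover have "closed {x::real^'n. \<forall>j. (if j \<in> I then x $ j else 0) = xI $ j}"
  proof (intro closed_Collect_all)
    show "closed {x::real^'n. (if j \<in> I then x $ j else 0) = xI $ j}" for j
      by (cases "j \<in> I") (auto intro!: closed_Collect_eq continuous_intros)
  qed
  moreover have "compact (X_MO A b I)"
    using assms closed_X_MO by (simp add: compact_eq_bounded_closed)
  ultimately show ?thesis
    by (simp add: compact_Int_closed closed_mult_vec_le)
qed

text \<open>A value of \<open>zbar\<close> below \<open>\<infinity>\<close> excludes an empty slice, over which the infimum is \<open>\<infinity>\<close>.\<close>

lemma zbar_attained:
  assumes "bounded (X_MO A b I)" "xI \<in> int_vecs I" "zbar A b I C \<zeta> xI < \<infinity>"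
  obtains x where "x \<in> slice A b I C \<zeta> xI" "zbar A b I C \<zeta> xI = ereal (c0 C \<bullet> x)"
proof -
  have ne: "slice A b I C \<zeta> xI \<noteq> {}"
    using assms(3) by (auto simp: zbar_eq_INF_slice[OF assms(2)] top_ereal_def)
  have "continuous_on (slice A b I C \<zeta> xI) (\<lambda>x. c0 C \<bullet> x)"
    by (intro continuous_intros)
  then obtain x where x: "x \<in> slice A b I C \<zeta> xI"
    and min: "\<And>x'. x' \<in> slice A b I C \<zeta> xI \<Longrightarrow> c0 C \<bullet> x \<le> c0 C \<bullet> x'"
    using continuous_attains_inf[OF compact_slice[OF assms(1)] ne] by blast
  have "zbar A b I C \<zeta> xI = ereal (c0 C \<bullet> x)"
    unfolding zbar_eq_INF_slice[OF assms(2)]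
    by (rule antisym) (auto intro: INF_lower2[OF x] INF_greatest simp: min)
  with x show ?thesis by (rule that)
qed

lemma finite_bounded_Ints_vec:
  assumes "bounded (S :: (real^'n::finite) set)" "\<And>x j. x \<in> S \<Longrightarrow> x $ j \<in> \<int>"
  shows "finite S"
proof -
  obtain B where B: "\<And>x. x \<in> S \<Longrightarrow> norm x \<le> B"
    using assms(1) by (auto simp: bounded_iff)
  let ?T = "{t::real. t \<in> \<int> \<and> \<bar>t\<bar> \<le> B}"
  have "S \<subseteq> vec_lambda ` (UNIV \<rightarrow>\<^sub>E ?T)"
  proof
    fix x assume "x \<in> S"
    then have PiE: "vec_nth x \<in> UNIV \<rightarrow>\<^sub>E ?T"
      using assms(2) order_trans[OF component_le_norm_cart B] by auto
    show "x \<in> vec_lambda ` (UNIV \<rightarrow>\<^sub>E ?T)"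
      by (rule rev_image_eqI[OF PiE]) simp
  qed
  moreover have "finite (UNIV \<rightarrow>\<^sub>E ?T :: ('n \<Rightarrow> real) set)"
    by (intro finite_PiE finite_abs_int_segment) auto
  ultimately show ?thesis
    by (meson finite_imageI finite_subset)
qed

lemma finite_int_parts:
  assumes "bounded (X_MO A b I)"
  shows "finite (int_part I ` X_MO A b I)"
proof (rule finite_bounded_Ints_vec)
  have "linear (int_part I)"
    by (rule linearI) (auto simp: int_part_def vec_eq_iff)
  then show "bounded (int_part I ` X_MO A b I)"
    by (intro bounded_linear_image assms) (simp add: linear_conv_bounded_linear)
qed (auto simp: int_part_def X_MO_def)

text \<open>
  Summing all objectives makes dominance strict: a solution that dominates another one has a
  smaller sum.  A minimizer of the sum among the solutions below \<open>y\<close> is therefore undominated.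
\<close>

lemma efficient_below:
  fixes A :: "real^'n::finite^'m::finite" and C :: "real^'n^('l::finite option)"
  assumes "bounded (X_MO A b I)" "y \<in> X_MO A b I"
  obtains x where "efficient A b I C x" "C *v x \<le> C *v y"
proof -
  let ?D = "X_MO A b I \<inter> {x. C *v x \<le> C *v y}"
  let ?s = "\<lambda>x. \<Sum>i\<in>UNIV. (C *v x) $ i"
  have "compact ?D"
    using assms(1) closed_X_MO
    by (intro compact_Int_closed closed_mult_vec_le) (simp add: compact_eq_bounded_closed)
  moreover have "continuous_on ?D ?s"
    by (intro continuous_intros)
  moreover have "?D \<noteq> {}"
    using assms(2) by auto
  ultimately obtain x where x: "x \<in> ?D" and min: "\<And>x'. x' \<in> ?D \<Longrightarrow> ?s x \<le> ?s x'"
    using continuous_attains_inf[of ?D ?s] by blast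
  have "\<not> dominates (C *v w) (C *v x)" if w: "w \<in> X_MO A b I" for w
  proof
    assume dom: "dominates (C *v w) (C *v x)"
    then have le: "\<forall>i. (C *v w) $ i \<le> (C *v x) $ i" and "\<exists>i. (C *v w) $ i \<noteq> (C *v x) $ i"
      by (auto simp: dominates_def less_eq_vec_def vec_eq_iff)
    then obtain i where "(C *v w) $ i < (C *v x) $ i"
      by (meson order_less_le)
    then have "?s w < ?s x"
      using le by (intro sum_strict_mono_ex1) auto
    moreover have "w \<in> ?D"
      using w x dom by (auto simp: dominates_def intro: order_trans)
    ultimately show False
      using min[of w] by simp
  qed
  then have "efficient A b I C x"
    using x by (auto simp: efficient_def efficient_frontier_def)
  with x show ?thesis
    using that by blast
qed

section \<open>The invariant of the iteration\<close>

definition approx ::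
  "real^'n::finite^'m::finite \<Rightarrow> real^'m \<Rightarrow> 'n set \<Rightarrow> real^'n^('l::finite option) \<Rightarrow> real \<Rightarrow>
    (real^'n) set \<Rightarrow> real^'l \<Rightarrow> ereal"
  where "approx A b I C U S \<zeta> = min (ereal U) (INF xI \<in> S. zbar A b I C \<zeta> xI)"

lemma approx_insert:
  "approx A b I C U (insert xI S) \<zeta> = min (approx A b I C U S \<zeta>) (zbar A b I C \<zeta> xI)"
  by (simp add: approx_def inf_min ac_simps)

lemma approx_antimono:
  assumes "S \<subseteq> int_vecs I" "\<zeta> \<le> \<zeta>'"
  shows "approx A b I C U S \<zeta>' \<le> approx A b I C U S \<zeta>"
  unfolding approx_def using assms
  by (intro min.mono order_refl INF_mono) (blast intro: zbar_antimono)

lemma rvf_le_approx: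
  assumes "S \<subseteq> int_vecs I" "rvf A b I C \<zeta> \<le> ereal U"
  shows "rvf A b I C \<zeta> \<le> approx A b I C U S \<zeta>"
  using assms by (auto simp: approx_def intro!: INF_greatest rvf_le_zbar)

lemma approx_le_objective:
  assumes "x \<in> X_MO A b I" "int_part I x \<in> S"
  shows "approx A b I C U S (C1 C *v x) \<le> ereal (c0 C \<bullet> x)"
  unfolding approx_def using assms
  by (intro min.coboundedI2 INF_lower2[OF assms(2)] zbar_int_part_le)

text \<open>
  The conversion to \<open>x\<close> cannot lower the gap, so \<open>\<theta> \<le> 0\<close> at \<open>x\<close> bounds the maximal gap at \<open>y\<close>.
  For an arbitrary right-hand side, each feasible \<open>w\<close> is judged at its own
  right-hand side \<open>C1 C *v w\<close>, and antitonicity transports the bound.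
\<close>

lemma approx_le_rvf:
  assumes S: "S \<subseteq> int_vecs I"
    and approx: "\<And>\<zeta>. \<zeta> \<in> feas_rhs A b I C \<Longrightarrow> zk \<zeta> = approx A b I C U S \<zeta>"
    and max: "is_max_gap A b I C zk y"
    and x: "x \<in> X_MO A b I" and le: "C *v x \<le> C *v y"
    and gap: "zk (C1 C *v x) - ereal (c0 C \<bullet> x) \<le> 0"
  shows "approx A b I C U S \<zeta> \<le> rvf A b I C \<zeta>"
  unfolding rvf_def
proof (rule INF_greatest)
  fix w assume w: "w \<in> feas A b I C \<zeta>"
  then have wX: "w \<in> X_MO A b I" and w\<zeta>: "C1 C *v w \<le> \<zeta>"
    by (auto simp: feas_def)
  have y: "y \<in> X_MO A b I"
    using max by (auto simp: is_max_gap_def is_arg_max_def)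
  have "zk (C1 C *v w) - ereal (c0 C \<bullet> w) \<le> zk (C1 C *v y) - ereal (c0 C \<bullet> y)"
    using max wX by (auto simp: is_max_gap_def is_arg_max_def not_less)
  also have "\<dots> \<le> zk (C1 C *v x) - ereal (c0 C \<bullet> x)"
    using le approx_antimono[OF S] x y
    by (intro ereal_minus_mono) (auto simp: mult_vec_le_iff approx mult_vec_in_feas_rhs)
  also have "\<dots> \<le> 0"
    by (rule gap)
  finally have "zk (C1 C *v w) \<le> ereal (c0 C \<bullet> w)"
    by (simp add: ereal_minus_le_iff)
  then have "approx A b I C U S (C1 C *v w) \<le> ereal (c0 C \<bullet> w)"
    by (simp add: approx[OF mult_vec_in_feas_rhs[OF wX]])
  with approx_antimono[OF S w\<zeta>] show "approx A b I C U S \<zeta> \<le> ereal (c0 C \<bullet> w)"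
    by (rule order_trans)
qed

text \<open>
  The last two conjuncts bound the number \<open>k\<close> of iterations by the number of integer parts: while
  the gap is positive, each iteration has contributed a new one.  Only the
  iteration that ends the loop may repeat an old one.
\<close>

definition invariant ::
  "real^'n::finite^'m::finite \<Rightarrow> real^'m \<Rightarrow> 'n set \<Rightarrow> real^'n^('l::finite option) \<Rightarrow> real \<Rightarrow> nat \<Rightarrow>
    ('n, 'l) rvf_state \<Rightarrow> bool"
  where "invariant A b I C U k = (\<lambda>(zk, Sk, \<theta>k).
    (\<forall>\<zeta> \<in> feas_rhs A b I C. zk \<zeta> = approx A b I C U Sk \<zeta>) \<and>
    Sk \<subseteq> int_part I ` X_MO A b I \<and>
    (\<theta>k \<le> 0 \<longrightarrow> (\<forall>\<zeta> \<in> feas_rhs A b I C. zk \<zeta> \<le> rvf A b I C \<zeta>)) \<and>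
    (\<theta>k > 0 \<longrightarrow> card Sk = k) \<and> k \<le> Suc (card Sk))"

lemma invariant_init: "invariant A b I C U 0 (rvf_init U)"
  by (simp add: invariant_def rvf_init_def approx_def top_ereal_def)

lemma invariant_step:
  assumes bdd: "bounded (X_MO A b I)"
    and inv: "invariant A b I C U k s" and step: "rvf_step A b I C s s'"
  shows "invariant A b I C U (Suc k) s'"
  using step
proof cases
  case (1 \<theta>k zk y x Sk)
  let ?p = "int_part I x" and ?\<theta> = "zk (C1 C *v x) - ereal (c0 C \<bullet> x)"
  let ?z = "\<lambda>\<zeta>. if \<zeta> \<in> feas_rhs A b I C then min (zk \<zeta>) (zbar A b I C \<zeta> ?p) else zk \<zeta>"
  have zk: "\<And>\<zeta>. \<zeta> \<in> feas_rhs A b I C \<Longrightarrow> zk \<zeta> = approx A b I C U Sk \<zeta>"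
    and sub: "Sk \<subseteq> int_part I ` X_MO A b I" and card: "card Sk = k"
    using inv 1 by (auto simp: invariant_def)
  have fin: "finite Sk"
    using sub finite_int_parts[OF bdd] by (rule finite_subset)
  have Sk: "Sk \<subseteq> int_vecs I"
    using sub int_part_in_int_vecs by blast
  have x: "x \<in> X_MO A b I"
    using 1 by (simp add: efficient_def)
  have "?z \<zeta> \<le> rvf A b I C \<zeta>" if "?\<theta> \<le> 0" "\<zeta> \<in> feas_rhs A b I C" for \<zeta>
    using approx_le_rvf[OF Sk zk \<open>is_max_gap A b I C zk y\<close> x \<open>C *v x \<le> C *v y\<close> that(1), of \<zeta>]
      that zk by (simp add: min.coboundedI1)
  moreover have new: "?p \<notin> Sk" if "?\<theta> > 0"
  proof
    assume "?p \<in> Sk"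
    from approx_le_objective[OF x this, of C U] have "?\<theta> \<le> 0"
      by (simp add: zk mult_vec_in_feas_rhs[OF x] ereal_minus_le_iff)
    with that show False by simp
  qed
  moreover have "Suc k \<le> Suc (card (insert ?p Sk))"
    using card fin by (simp add: card_insert_if)
  ultimately show ?thesis
    using 1 x sub fin card by (auto simp: invariant_def zk approx_insert)
qed

lemma invariant_reachable:
  assumes "bounded (X_MO A b I)"
  shows "(rvf_step A b I C ^^ k) (rvf_init U) s \<Longrightarrow> invariant A b I C U k s"
proof (induction k arbitrary: s)
  case 0
  then show ?case using invariant_init by auto
next
  case (Suc k)
  then show ?case by (auto intro: invariant_step[OF assms])
qed

section \<open>Descriptions of the value function and of the efficient frontier\<close>

text \<open>
  The strict bound \<open>rvf < U\<close> forces the minimum to be attained by one of the finitely many \<open>zbar\<close>.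
\<close>

lemma describes_rvf_if_approx_le:
  assumes bdd: "bounded (X_MO A b I)" and sub: "S \<subseteq> int_part I ` X_MO A b I"
    and le: "\<And>\<zeta>. \<zeta> \<in> feas_rhs A b I C \<Longrightarrow> approx A b I C U S \<zeta> \<le> rvf A b I C \<zeta>"
    and U: "\<And>\<zeta>. \<zeta> \<in> feas_rhs A b I C \<Longrightarrow> rvf A b I C \<zeta> < ereal U"
  shows "describes_rvf A b I C S"
  unfolding describes_rvf_def
proof (intro conjI ballI)
  show "S \<subseteq> S_I A b I C"
    using sub int_part_in_S_I by blast
next
  fix \<zeta> assume \<zeta>: "\<zeta> \<in> feas_rhs A b I C"
  have inf: "(INF xI \<in> S. zbar A b I C \<zeta> xI) \<le> rvf A b I C \<zeta>"
    using le[OF \<zeta>] U[OF \<zeta>] by (auto simp: approx_def min_le_iff_disj)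
  then have "S \<noteq> {}"
    using U[OF \<zeta>] by (auto simp: top_ereal_def)
  moreover have "finite S"
    using sub finite_int_parts[OF bdd] by (rule finite_subset)
  ultimately have "(INF xI \<in> S. zbar A b I C \<zeta> xI) \<in> zbar A b I C \<zeta> ` S"
    by (metis Min_Inf Min_in finite_imageI image_is_empty)
  then obtain xI where xI: "xI \<in> S" and "zbar A b I C \<zeta> xI \<le> rvf A b I C \<zeta>"
    using inf by auto
  moreover have int: "xI \<in> int_vecs I"
    using xI sub int_part_in_int_vecs by blast
  ultimately have eq: "zbar A b I C \<zeta> xI = rvf A b I C \<zeta>"
    using rvf_le_zbar antisym by metis
  moreover have "rvf A b I C \<zeta> < \<infinity>"
    using U[OF \<zeta>] by auto
  ultimately obtain x where x: "x \<in> slice A b I C \<zeta> xI"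
    and opt: "rvf A b I C \<zeta> = ereal (c0 C \<bullet> x)"
    using zbar_attained[OF bdd int, of C \<zeta>] by metis
  obtain xC where "xC \<in> cont_vecs I" "x = xI + xC"
    "C1 C *v xC \<le> \<zeta> - C1 C *v xI" "A *v xC = b - A *v xI"
    using x unfolding slice_eq_image[OF int] by auto
  with opt show "\<exists>xI\<in>S. \<exists>xC\<in>cont_vecs I. C1 C *v xI + C1 C *v xC \<le> \<zeta> \<and>
      A *v xI + A *v xC = b \<and> ereal (c0 C \<bullet> xI + c0 C \<bullet> xC) = rvf A b I C \<zeta>"
    using xI by (intro bexI[of _ xI] bexI[of _ xC]) (auto simp: inner_add_right algebra_simps)
qed

text \<open>
  An efficient solution \<open>x\<close> is feasible for the right-hand side \<open>C1 C *v x\<close>.  An optimal solution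
  there is at least as good as \<open>x\<close> in every objective, so efficiency makes the two
  vectors equal.
\<close>

lemma describes_ef_if_describes_rvf:
  assumes "describes_rvf A b I C S"
  shows "describes_ef A b I C S"
  unfolding describes_ef_def
proof (intro conjI ballI)
  show "S \<subseteq> S_I A b I C"
    using assms by (simp add: describes_rvf_def)
next
  fix \<gamma> assume "\<gamma> \<in> efficient_frontier A b I C"
  then obtain x where x: "x \<in> X_MO A b I" and \<gamma>: "\<gamma> = C *v x"
    and nondom: "\<And>y. y \<in> X_MO A b I \<Longrightarrow> \<not> dominates (C *v y) (C *v x)"
    by (auto simp: efficient_frontier_def)
  obtain xI xC where xI: "xI \<in> S" and xC: "xC \<in> cont_vecs I"
    and C1: "C1 C *v xI + C1 C *v xC \<le> C1 C *v x" and A: "A *v xI + A *v xC = b"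
    and opt: "ereal (c0 C \<bullet> xI + c0 C \<bullet> xC) = rvf A b I C (C1 C *v x)"
    using assms mult_vec_in_feas_rhs[OF x] unfolding describes_rvf_def by blast
  have "xI \<in> int_vecs I"
    using assms xI by (auto simp: describes_rvf_def S_I_def)
  then have fe: "xI + xC \<in> feas A b I C (C1 C *v x)"
    using C1 A xC by (simp add: add_in_feas_iff) (simp add: algebra_simps)
  then have X: "xI + xC \<in> X_MO A b I"
    by (simp add: feas_def)
  have "rvf A b I C (C1 C *v x) \<le> ereal (c0 C \<bullet> x)"
    unfolding rvf_def using x by (intro INF_lower) (simp add: feas_def)
  then have "c0 C \<bullet> (xI + xC) \<le> c0 C \<bullet> x"
    by (simp add: opt[symmetric] inner_add_right)
  then have "C *v (xI + xC) \<le> C *v x"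
    using fe by (simp add: mult_vec_le_iff feas_def)
  then have "C *v (xI + xC) = C *v x"
    using nondom[OF X] by (simp add: dominates_def)
  then show "\<exists>xI\<in>S. \<exists>xC\<in>cont_vecs I. xI + xC \<in> X_MO A b I \<and> \<gamma> = C *v xI + C *v xC"
    using xI xC X by (metis \<gamma> matrix_vector_right_distrib)
qed

section \<open>Correctness and termination\<close>

theorem theorem3:
  fixes A :: "real^'n::finite^'m::finite" and b :: "real^'m" and I :: "'n set"
    and C :: "real^'n^('l::finite option)" and U :: real
  assumes "\<forall>i j. A $ i $ j \<in> \<rat>" and "\<forall>i. b $ i \<in> \<rat>" and "\<forall>i j. C $ i $ j \<in> \<rat>"
    and "bounded (X_MO A b I)"
    and "\<forall>\<zeta> \<in> feas_rhs A b I C. rvf A b I C \<zeta> \<le> ereal U"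
  shows
    "(\<forall>k zk Sk \<theta>k. (rvf_step A b I C ^^ k) (rvf_init U) (zk, Sk, \<theta>k) \<and> \<not> \<theta>k > 0 \<longrightarrow>
        (\<forall>\<zeta> \<in> feas_rhs A b I C. rvf A b I C \<zeta> = zk \<zeta>) \<and>
        ((\<forall>\<zeta> \<in> feas_rhs A b I C. rvf A b I C \<zeta> < ereal U) \<longrightarrow>
          describes_rvf A b I C Sk \<and> describes_ef A b I C Sk)) \<and>
     (\<exists>N. \<forall>k s. (rvf_step A b I C ^^ k) (rvf_init U) s \<longrightarrow> k \<le> N) \<and>
     (\<forall>k zk Sk \<theta>k. (rvf_step A b I C ^^ k) (rvf_init U) (zk, Sk, \<theta>k) \<and>
        \<theta>k > 0 \<and> (\<exists>y. is_max_gap A b I C zk y) \<longrightarrow>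
        (\<exists>s. rvf_step A b I C (zk, Sk, \<theta>k) s))"
proof (intro conjI allI impI)
  fix k zk Sk \<theta>k
  assume "(rvf_step A b I C ^^ k) (rvf_init U) (zk, Sk, \<theta>k) \<and> \<not> \<theta>k > 0"
  then have inv: "invariant A b I C U k (zk, Sk, \<theta>k)" and "\<theta>k \<le> 0"
    using invariant_reachable[OF assms(4)] by auto
  then have zk: "\<And>\<zeta>. \<zeta> \<in> feas_rhs A b I C \<Longrightarrow> zk \<zeta> = approx A b I C U Sk \<zeta>"
    and le: "\<And>\<zeta>. \<zeta> \<in> feas_rhs A b I C \<Longrightarrow> approx A b I C U Sk \<zeta> \<le> rvf A b I C \<zeta>"
    and sub: "Sk \<subseteq> int_part I ` X_MO A b I"
    by (auto simp: invariant_def)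
  have Sk: "Sk \<subseteq> int_vecs I"
    using sub int_part_in_int_vecs by blast
  show "\<forall>\<zeta> \<in> feas_rhs A b I C. rvf A b I C \<zeta> = zk \<zeta>"
    using zk le rvf_le_approx[OF Sk] assms(5) by (metis antisym)
  assume U: "\<forall>\<zeta> \<in> feas_rhs A b I C. rvf A b I C \<zeta> < ereal U"
  show "describes_rvf A b I C Sk"
    by (rule describes_rvf_if_approx_le[OF assms(4) sub le]) (use U in auto)
  then show "describes_ef A b I C Sk"
    by (rule describes_ef_if_describes_rvf)
next
  have "k \<le> Suc (card (int_part I ` X_MO A b I))"
    if "(rvf_step A b I C ^^ k) (rvf_init U) s" for k s
  proof -
    have "k \<le> Suc (card (fst (snd s)))" "fst (snd s) \<subseteq> int_part I ` X_MO A b I"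
      using invariant_reachable[OF assms(4) that] by (auto simp: invariant_def split: prod.splits)
    moreover from this(2) have "card (fst (snd s)) \<le> card (int_part I ` X_MO A b I)"
      using finite_int_parts[OF assms(4)] by (intro card_mono)
    ultimately show ?thesis by simp
  qed
  then show "\<exists>N. \<forall>k s. (rvf_step A b I C ^^ k) (rvf_init U) s \<longrightarrow> k \<le> N"
    by blast
next
  fix k zk Sk \<theta>k
  assume "(rvf_step A b I C ^^ k) (rvf_init U) (zk, Sk, \<theta>k) \<and> \<theta>k > 0 \<and>
    (\<exists>y. is_max_gap A b I C zk y)"
  then obtain y where pos: "\<theta>k > 0" and max: "is_max_gap A b I C zk y"
    by blast
  then have "y \<in> X_MO A b I"
    by (simp add: is_max_gap_def is_arg_max_def)
  from efficient_below[OF assms(4) this] obtain x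
    where "efficient A b I C x" "C *v x \<le> C *v y" .
  with pos max show "\<exists>s. rvf_step A b I C (zk, Sk, \<theta>k) s"
    by (blast intro: rvf_step.intros)
qed

end
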